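(* Let $X$ be a real or complex Banach space and let $(A(n))_{n\in\mathbb{N}}$ be a sequence in $\mathcal{B}(X)$. The linear discrete-time system $x_{n+1}=A(n)x_n$, $n\in\mathbb{N}$, is nonuniformly power instable (NPIS) if and only if there exist a Lyapunov sequence $L:\Delta\times X\to\mathbb{R}_+$ for the system and a nondecreasing sequence $\beta:\mathbb{N}\to[1,\infty)$ such that $$L(m,n,x)\le \beta(m)\,\|\mathcal{A}(m,n)x\|$$ for all $(m,n,x)\in\Delta\times X$.
   Context: $\mathcal{B}(X)$ is the space of bounded linear operators on $X$; $\|\cdot\|$ denotes the norm on $X$; $\mathbb{R}_+=[0,\infty)$. $\mathbb{N}=\{0,1,2,\dots\}$ and $\Delta=\{(m,n)\in\mathbb{N}^2: m\ge n\}$. For $(m,n)\in\Delta$, $\mathcal{A}(m,n)=A(m-1)\cdots A(n)$ if $m\ge n+1$ and $\mathcal{A}(n,n)=I$ (the identity). The system is nonuniformly power instable (NPIS) if there exist a nondecreasing sequence $N:\mathbb{N}\to[1,\infty)$ and $r\in(0,1)$ such that $\|\mathcal{A}(n,l)x\|\le N(m)\,r^{m-n}\,\|\mathcal{A}(m,l)x\|$ for all $m,n,l\in\mathbb{N}$ with $m\ge n\ge l$ and all $x\in X$. A function $L:\Delta\times X\to\mathbb{R}_+$ is a Lyapunov sequence for the system if there exists a constant $a\in(1,\infty)$ such that $L(n,n,x)=\|x\|$ for all $n\in\mathbb{N}$, $x\in X$, and $L(m,n,x)-a\,L(m-1,n,x)\ge\|\mathcal{A}(m,n)x\|$ for all $(m,n,x)\in\Delta\times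 X$ with $m>n$. *)

theory Defs
  imports "HOL-Analysis.Bounded_Linear_Function"
begin

text \<open>
  Class \<open>banach\<close> is the class of real Banach spaces. Complex Banach spaces are covered as well, by
  restriction of scalars: a complex Banach space is a real one with the same norm, its bounded
  complex-linear operators are bounded real-linear operators, and the notions below involve only
  norms and composition of operators, never the scalar field.
\<close>

text \<open>
  \<open>evol A m n = A (m - 1) \<circ> \<dots> \<circ> A n\<close> if \<open>n < m\<close>, and the identity if \<open>m = n\<close>. The value for \<open>m < n\<close>
  (also the identity) is never used.
\<close>
primrec evol ::
  "(nat \<Rightarrow> 'a::real_normed_vector \<Rightarrow>\<^sub>L 'a) \<Rightarrow> nat \<Rightarrow> nat \<Rightarrow> 'a \<Rightarrow>\<^sub>L 'a" where
  "evol A 0 n = id_blinfun"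
| "evol A (Suc m) n = (if n \<le> m then A m o\<^sub>L evol A m n else id_blinfun)"

lemma evol_refl: "evol A n n = id_blinfun"
  by (cases n) simp_all

lemma evol_step: "n < m \<Longrightarrow> evol A m n = A (m - 1) o\<^sub>L evol A (m - 1) n"
  by (cases m) simp_all

definition nonuniformly_power_instable ::
  "(nat \<Rightarrow> 'a::real_normed_vector \<Rightarrow>\<^sub>L 'a) \<Rightarrow> bool" where
  "nonuniformly_power_instable A \<longleftrightarrow>
    (\<exists>(N :: nat \<Rightarrow> real) (r :: real). mono N \<and> (\<forall>k. 1 \<le> N k) \<and> 0 < r \<and> r < 1 \<and>
      (\<forall>m n l x. l \<le> n \<longrightarrow> n \<le> m \<longrightarrow>
        norm (evol A n l x) \<le> N m * r ^ (m - n) * norm (evol A m l x)))"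

text \<open>
  A function on pairs \<open>m \<ge> n\<close> is represented by a total one, whose values at \<open>m < n\<close> are
  unconstrained.
\<close>
definition lyapunov_sequence ::
  "(nat \<Rightarrow> 'a::real_normed_vector \<Rightarrow>\<^sub>L 'a) \<Rightarrow> (nat \<Rightarrow> nat \<Rightarrow> 'a \<Rightarrow> real) \<Rightarrow> bool" where
  "lyapunov_sequence A L \<longleftrightarrow>
    (\<forall>m n x. n \<le> m \<longrightarrow> 0 \<le> L m n x) \<and>
    (\<exists>a>1. (\<forall>n x. L n n x = norm x) \<and>
      (\<forall>m n x. n < m \<longrightarrow> L m n x - a * L (m - 1) n x \<ge> norm (evol A m n x)))"

end

theory Submission
  imports Defs
begin

text \<open>
  Both conditions say that orbits grow at a geometric rate, up to a factor that depends only on the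
  final time.

  A Lyapunov sequence dominates the norm of the orbit and grows at least by the factor \<open>a\<close> in each
  step, whence \<open>norm (evol A n l x) \<le> L n l x \<le> (1 / a) ^ (m - n) * L m l x\<close>, and the upper bound
  on \<open>L\<close> at time \<open>m\<close> turns this into instability with rate \<open>r = 1 / a\<close>.

  Conversely, solving the recursion \<open>L m n x = a * L (m - 1) n x + norm (evol A m n x)\<close> with
  \<open>L n n x = norm x\<close> yields a weighted sum of the norms along the orbit (\<open>weighted_orbit_sum\<close>),
  which is a Lyapunov sequence for every \<open>a > 1\<close>. For \<open>a = 1 / r\<close> the weights cancel the
  geometric factors of the instability estimate exactly, so each of the at most \<open>m + 1\<close> summands
  is bounded by \<open>N m * norm (evol A m n x)\<close>. The linear factor \<open>m + 1\<close> does no harm because the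
  bound \<open>\<beta>\<close> may be any nondecreasing sequence.
\<close>

definition weighted_orbit_sum ::
  "(nat \<Rightarrow> 'a::real_normed_vector \<Rightarrow>\<^sub>L 'a) \<Rightarrow> real \<Rightarrow> nat \<Rightarrow> nat \<Rightarrow> 'a \<Rightarrow> real" where
  "weighted_orbit_sum A a m n x = (\<Sum>k=n..m. a ^ (m - k) * norm (evol A k n x))"

lemma weighted_orbit_sum_refl: "weighted_orbit_sum A a n n x = norm x"
  by (simp add: weighted_orbit_sum_def evol_refl)

lemma weighted_orbit_sum_Suc:
  assumes "n \<le> m"
  shows "weighted_orbit_sum A a (Suc m) n x =
    a * weighted_orbit_sum A a m n x + norm (evol A (Suc m) n x)"
proof -
  have "(\<Sum>k=n..m. a ^ (Suc m - k) * norm (evol A k n x)) =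
      a * (\<Sum>k=n..m. a ^ (m - k) * norm (evol A k n x))"
    unfolding sum_distrib_left by (rule sum.cong) (simp_all add: Suc_diff_le)
  then show ?thesis
    using assms by (simp add: weighted_orbit_sum_def del: evol.simps)
qed

lemma lyapunov_sequence_weighted_orbit_sum:
  assumes "1 < a"
  shows "lyapunov_sequence A (weighted_orbit_sum A a)"
proof -
  have "0 \<le> weighted_orbit_sum A a m n x" for m n x
    using assms by (simp add: weighted_orbit_sum_def sum_nonneg)
  moreover have "norm (evol A m n x) \<le>
      weighted_orbit_sum A a m n x - a * weighted_orbit_sum A a (m - 1) n x"
    if "n < m" for m n x
    using that weighted_orbit_sum_Suc[of n "m - 1" A a x] by simp
  ultimately show ?thesis
    using assms weighted_orbit_sum_refl unfolding lyapunov_sequence_def by blast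
qed

text \<open>
  The factor \<open>a = 1 / r\<close> is chosen so that \<open>a ^ (m - k)\<close> cancels \<open>r ^ (m - k)\<close>. Every summand then
  has the same bound, and only their number has to be counted.
\<close>
lemma weighted_orbit_sum_le:
  assumes "0 < r" and "1 \<le> C"
    and decay: "\<And>k. n \<le> k \<Longrightarrow> k \<le> m \<Longrightarrow>
      norm (evol A k n x) \<le> C * r ^ (m - k) * norm (evol A m n x)"
  shows "weighted_orbit_sum A (1 / r) m n x \<le> real (m + 1) * C * norm (evol A m n x)"
proof -
  have summand: "(1 / r) ^ (m - k) * norm (evol A k n x) \<le> C * norm (evol A m n x)"
    if "k \<in> {n..m}" for k
  proof -
    have "(1 / r) ^ (m - k) * norm (evol A k n x) \<le>
        (1 / r) ^ (m - k) * (C * r ^ (m - k) * norm (evol A m n x))"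
      using that \<open>0 < r\<close> by (intro mult_left_mono decay) auto
    also have "\<dots> = C * norm (evol A m n x)"
      using \<open>0 < r\<close> by (simp add: power_one_over)
    finally show ?thesis .
  qed
  have "weighted_orbit_sum A (1 / r) m n x \<le> real (card {n..m}) * (C * norm (evol A m n x))"
    unfolding weighted_orbit_sum_def by (rule sum_bounded_above) (rule summand)
  also have "\<dots> \<le> real (m + 1) * (C * norm (evol A m n x))"
    using \<open>1 \<le> C\<close> by (intro mult_right_mono) auto
  finally show ?thesis by (simp add: mult.assoc)
qed

lemma geometric_growth:
  fixes f :: "nat \<Rightarrow> real"
  assumes "0 \<le> a" and "n \<le> m"
    and step: "\<And>k. n \<le> k \<Longrightarrow> a * f k \<le> f (Suc k)"
  shows "a ^ (m - n) * f n \<le> f m"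
  using \<open>n \<le> m\<close>
proof (induction m rule: dec_induct)
  case base
  show ?case by simp
next
  case (step k)
  have "a ^ (Suc k - n) * f n = a * (a ^ (k - n) * f n)"
    using step.hyps by (simp add: Suc_diff_le)
  also have "\<dots> \<le> a * f k"
    using step.IH \<open>0 \<le> a\<close> by (rule mult_left_mono)
  also have "\<dots> \<le> f (Suc k)"
    using step.hyps by (intro assms(3))
  finally show ?case .
qed

text \<open>
  Both summands in \<open>a * L (m - 1) n x + norm (evol A m n x) \<le> L m n x\<close> are nonnegative, so either may
  be dropped. Keeping the norm shows that \<open>L\<close> dominates the orbit, keeping the other summand shows
  that \<open>L\<close> grows geometrically; the estimate chains the two.
\<close>
lemma lyapunov_sequence_dominates_past:
  assumes "lyapunov_sequence A L"
  obtains a where "1 < a"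
    and "\<And>m n l x. l \<le> n \<Longrightarrow> n \<le> m \<Longrightarrow> norm (evol A n l x) \<le> (1 / a) ^ (m - n) * L m l x"
proof -
  obtain a where a: "1 < a" and start: "\<And>n x. L n n x = norm x"
    and nonneg: "\<And>m n x. n \<le> m \<Longrightarrow> 0 \<le> L m n x"
    and incr: "\<And>m n x. n < m \<Longrightarrow> norm (evol A m n x) \<le> L m n x - a * L (m - 1) n x"
    using assms unfolding lyapunov_sequence_def by blast
  have "norm (evol A n l x) \<le> (1 / a) ^ (m - n) * L m l x" if "l \<le> n" "n \<le> m" for m n l x
  proof -
    have "norm (evol A n l x) \<le> L n l x"
    proof (cases "l = n")
      case True
      then show ?thesis by (simp add: start evol_refl)
    next
      case False
      with \<open>l \<le> n\<close> have "l < n" by simp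
      then have "0 \<le> a * L (n - 1) l x"
        using a nonneg[of l "n - 1" x] by simp
      with incr[OF \<open>l < n\<close>, of x] show ?thesis by linarith
    qed
    moreover have "a ^ (m - n) * L n l x \<le> L m l x"
    proof (rule geometric_growth[where f = "\<lambda>k. L k l x"])
      show "a * L k l x \<le> L (Suc k) l x" if "n \<le> k" for k
      proof -
        have "norm (evol A (Suc k) l x) \<le> L (Suc k) l x - a * L k l x"
          using incr[of l "Suc k" x] that \<open>l \<le> n\<close> by (simp del: evol.simps)
        then show ?thesis
          using norm_ge_zero[of "evol A (Suc k) l x"] by linarith
      qed
    qed (use a \<open>n \<le> m\<close> in auto)
    then have "L n l x \<le> (1 / a) ^ (m - n) * L m l x"
      using a by (simp add: power_one_over pos_le_divide_eq mult.commute)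
    ultimately show ?thesis by linarith
  qed
  with a show ?thesis by (rule that)
qed

theorem theorem7:
  fixes A :: "nat \<Rightarrow> 'a::banach \<Rightarrow>\<^sub>L 'a"
  shows "nonuniformly_power_instable A \<longleftrightarrow>
    (\<exists>(L :: nat \<Rightarrow> nat \<Rightarrow> 'a \<Rightarrow> real) (\<beta> :: nat \<Rightarrow> real).
      lyapunov_sequence A L \<and> mono \<beta> \<and> (\<forall>k. 1 \<le> \<beta> k) \<and>
      (\<forall>m n x. n \<le> m \<longrightarrow> L m n x \<le> \<beta> m * norm (evol A m n x)))"
    (is "_ \<longleftrightarrow> ?bounded_lyapunov")
proof
  assume "nonuniformly_power_instable A"
  then obtain N r where N: "mono N" "\<And>k. 1 \<le> N k" and r: "0 < r" "r < 1"
    and instable: "\<And>m n l x. l \<le> n \<Longrightarrow> n \<le> m \<Longrightarrow>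
      norm (evol A n l x) \<le> N m * r ^ (m - n) * norm (evol A m l x)"
    unfolding nonuniformly_power_instable_def by blast
  let ?L = "weighted_orbit_sum A (1 / r)" and ?\<beta> = "\<lambda>m. real (m + 1) * N m"
  have "lyapunov_sequence A ?L"
    using r by (intro lyapunov_sequence_weighted_orbit_sum) simp
  moreover have "mono ?\<beta>"
  proof (rule monoI)
    fix i j :: nat
    assume "i \<le> j"
    then show "?\<beta> i \<le> ?\<beta> j"
      using N(2)[of i] monoD[OF N(1)] by (intro mult_mono) auto
  qed
  moreover have "1 \<le> ?\<beta> k" for k
    using mult_mono[of 1 "real (k + 1)" 1 "N k"] N(2)[of k] by simp
  moreover have "?L m n x \<le> ?\<beta> m * norm (evol A m n x)" for m n x
    using r(1) N(2) by (rule weighted_orbit_sum_le) (rule instable)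
  ultimately show ?bounded_lyapunov by blast
next
  assume ?bounded_lyapunov
  then obtain L \<beta> where L: "lyapunov_sequence A L" and \<beta>: "mono \<beta>" "\<forall>k. 1 \<le> \<beta> k"
    and bound: "\<And>m n x. n \<le> m \<Longrightarrow> L m n x \<le> \<beta> m * norm (evol A m n x)"
    by blast
  obtain a where a: "1 < a" and past: "\<And>m n l x. l \<le> n \<Longrightarrow> n \<le> m \<Longrightarrow>
      norm (evol A n l x) \<le> (1 / a) ^ (m - n) * L m l x"
    using lyapunov_sequence_dominates_past[OF L] by blast
  have "norm (evol A n l x) \<le> \<beta> m * (1 / a) ^ (m - n) * norm (evol A m l x)"
    if "l \<le> n" "n \<le> m" for m n l x
  proof -
    have "norm (evol A n l x) \<le> (1 / a) ^ (m - n) * L m l x"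
      using that by (rule past)
    also have "\<dots> \<le> (1 / a) ^ (m - n) * (\<beta> m * norm (evol A m l x))"
      using that a by (intro mult_left_mono bound) auto
    finally show ?thesis by (simp add: mult_ac)
  qed
  moreover have "0 < 1 / a" "1 / a < 1"
    using a by auto
  ultimately show "nonuniformly_power_instable A"
    using \<beta> unfolding nonuniformly_power_instable_def by blast
qed

end
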